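(* Let $F_{\mathbb N}=\{f_n\}_{n\in\mathbb N}$ be a sequence of inner functions that are centred and uniformly contracting, i.e. $f_n(0)=0$ for all $n$ and there is $\alpha<1$ with $|f_n'(0)|\le\alpha$ for all $n$; let $F_n=f_n\circ\cdots\circ f_1$. Let $\{r_n\}_{n\in\mathbb N}$ be a sequence of positive real numbers with $\sum_{n=1}^\infty r_n<\infty$. Then the recurrence set $$\mathcal R(F_{\mathbb N},\{r_n\}):=\{z\in\partial\mathbb D:F_n(z)\in B(z,r_n)\text{ for infinitely many }n\in\mathbb N\}$$ satisfies $\lambda(\mathcal R(F_{\mathbb N},\{r_n\}))=0$.
   Context: $\mathbb D$ is the open unit disk in $\mathbb C$, $\lambda$ is normalised Lebesgue measure on $\partial\mathbb D$, and balls in $\partial\mathbb D$ are taken with respect to normalised arc-length distance $d$. An inner function is a holomorphic map $f:\mathbb D\to\mathbb D$ such that for $\lambda$-almost every $e^{i\theta}$ the radial limit $\lim_{r\to1^-}f(re^{i\theta})$ exists and lies in $\partial\mathbb D$; the resulting ($\lambda$-a.e. defined) boundary map is also denoted $f$, and $F_n$ on $\partial\mathbb D$ denotes the ($\lambda$-a.e. defined) composition of the boundary maps. *)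

theory Defs
  imports "HOL-Complex_Analysis.Complex_Analysis"
begin

abbreviation unit_disk :: "complex set" where
  "unit_disk \<equiv> ball 0 1"

abbreviation unit_circle :: "complex set" where
  "unit_circle \<equiv> sphere 0 1"

(* The completion makes every subset of a null set measurable, as for Lebesgue measure. *)
definition circle_measure :: "complex measure" where
  "circle_measure =
     completion (distr (uniform_measure lborel {0..<2 * pi}) (restrict_space borel unit_circle) cis)"

(* Only meant for points of the unit circle. Arg takes values in (-pi, pi], so this is the length of
   the shortest arc from z to w, in units where the whole circle has length 1. *)
definition circle_dist :: "complex \<Rightarrow> complex \<Rightarrow> real" where
  "circle_dist z w = \<bar>Arg (w / z)\<bar> / (2 * pi)"

definition circle_ball :: "complex \<Rightarrow> real \<Rightarrow> complex set" where
  "circle_ball z \<rho> = {w \<in> unit_circle. circle_dist z w < \<rho>}"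

definition has_radial_limit :: "(complex \<Rightarrow> complex) \<Rightarrow> complex \<Rightarrow> complex \<Rightarrow> bool" where
  "has_radial_limit f z w \<longleftrightarrow> ((\<lambda>t::real. f (of_real t * z)) \<longlongrightarrow> w) (at_left 1)"

definition inner_function :: "(complex \<Rightarrow> complex) \<Rightarrow> bool" where
  "inner_function f \<longleftrightarrow>
     f holomorphic_on unit_disk \<and> f ` unit_disk \<subseteq> unit_disk \<and>
     (AE z in circle_measure. \<exists>w\<in>unit_circle. has_radial_limit f z w)"

(* A partial map: None at the points of the circle where the radial limit does not exist or
   does not lie on the circle (a null set if f is inner). *)
definition boundary_map :: "(complex \<Rightarrow> complex) \<Rightarrow> complex \<rightharpoonup> complex" where
  "boundary_map f z =
     (if z \<in> unit_circle \<and> (\<exists>w\<in>unit_circle. has_radial_limit f z w)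
      then Some (THE w. has_radial_limit f z w) else None)"

(* The composition of the boundary maps of f n, ..., f 1, in this order; f 0 plays no role. *)
primrec boundary_iter :: "(nat \<Rightarrow> complex \<Rightarrow> complex) \<Rightarrow> nat \<Rightarrow> complex \<rightharpoonup> complex" where
  "boundary_iter f 0 = Some"
| "boundary_iter f (Suc n) = boundary_map (f (Suc n)) \<circ>\<^sub>m boundary_iter f n"

(* The index n = 0 is harmless here: it does not affect what happens infinitely often. *)
definition recurrence_set :: "(nat \<Rightarrow> complex \<Rightarrow> complex) \<Rightarrow> (nat \<Rightarrow> real) \<Rightarrow> complex set" where
  "recurrence_set f r =
     {z \<in> unit_circle. \<exists>\<^sub>\<infinity>n. \<exists>w. boundary_iter f n z = Some w \<and> w \<in> circle_ball z (r n)}"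

lemma boundary_map_eq_Some_iff:
  "boundary_map f z = Some w \<longleftrightarrow> z \<in> unit_circle \<and> w \<in> unit_circle \<and> has_radial_limit f z w"
proof -
  have uniq: "a = b" if "has_radial_limit f z a" "has_radial_limit f z b" for a b
    using that tendsto_unique[of "at_left (1::real)"] unfolding has_radial_limit_def by auto
  then have "(THE w. has_radial_limit f z w) = a" if "has_radial_limit f z a" for a
    using that by blast
  then show ?thesis
    unfolding boundary_map_def using uniq by auto
qed

lemma circle_dist_cis:
  assumes "\<bar>a - b\<bar> \<le> pi"
  shows "circle_dist (cis a) (cis b) = \<bar>a - b\<bar> / (2 * pi)"
proof -
  have "\<bar>Arg (cis (b - a))\<bar> = \<bar>a - b\<bar>"
  proof (cases "b - a = -pi")
    case True
    then have "cis (b - a) = cis pi"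
      by (simp add: complex_eq_iff)
    then show ?thesis
      using True Arg_cis[of pi] by (simp add: abs_minus_commute[of a b])
  next
    case False
    then have "Arg (cis (b - a)) = b - a"
      using assms by (intro Arg_cis) auto
    then show ?thesis by auto
  qed
  then show ?thesis by (simp add: circle_dist_def cis_divide)
qed

lemma measurable_cis_circle:
  "cis \<in> uniform_measure lborel {0..<2 * pi} \<rightarrow>\<^sub>M restrict_space borel unit_circle"
proof -
  have "cis \<in> borel_measurable borel"
    by (intro borel_measurable_continuous_onI continuous_intros)
  then show ?thesis
    by (intro measurable_restrict_space2) (auto simp: measurable_def[of borel borel] measurable_def[of "uniform_measure _ _"])
qed

lemma space_circle_measure [simp]: "space circle_measure = unit_circle"
  by (simp add: circle_measure_def space_restrict_space)

lemma emeasure_circle_measure_circle: "emeasure circle_measure unit_circle = 1"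
proof -
  have S: "unit_circle \<in> sets (restrict_space borel unit_circle)"
    using sets.top[of "restrict_space borel unit_circle"] by (simp add: space_restrict_space)
  have "cis -` unit_circle = UNIV" by auto
  moreover have "emeasure lborel {0..<2 * pi} \<noteq> 0"
    using pi_gt_zero by (simp add: ennreal_eq_0_iff not_le del: pi_gt_zero)
  ultimately show ?thesis
    unfolding circle_measure_def using S
    by (simp add: emeasure_distr[OF measurable_cis_circle] ennreal_divide_self)
qed

end

theory Submission
  imports Defs
begin

text \<open>Write \<open>a\<close> for the derivative at \<open>0\<close> of \<open>F\<^sub>n\<close>. The function \<open>F\<^sub>n\<^sup>m\<close> has a zero of order at least \<open>m\<close>
  at the origin, with leading coefficient \<open>a\<^sup>m\<close>. Hence the integral of \<open>(F\<^sub>n(z) / z)\<^sup>m\<close> over the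
  circle is \<open>a\<^sup>m\<close>, and \<open>F\<^sub>n(z) / z\<close> is distributed according to the Poisson kernel at \<open>a\<close>. Uniform
  contraction bounds this kernel by \<open>(1 + \<alpha>) / (1 - \<alpha>)\<close>, so \<open>F\<^sub>n(z) \<in> B(z, r\<^sub>n)\<close> has probability at most
  \<open>2 r\<^sub>n (1 + \<alpha>) / (1 - \<alpha>)\<close>, and the Borel--Cantelli lemma applies. The moments of the composed
  boundary maps are computed by induction on \<open>n\<close>, one radial limit at a time; the case of plain moments
  shows that every \<open>F\<^sub>n\<close> preserves the measure of the circle, so that null sets pull back.\<close>

section \<open>Normalised arc length as a Borel measure on the plane\<close>

text \<open>\<open>circle_measure\<close> lives on a restricted space and is completed, which makes
  measurability awkward. This version has the whole plane as its space and the Borel sets as its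
  sigma-algebra. Only almost-everywhere statements have to be carried over.\<close>

definition circle_borel :: "complex measure" where
  "circle_borel = distr (uniform_measure lborel {0..<2 * pi}) borel cis"

lemma measurable_cis [measurable]: "cis \<in> borel_measurable borel"
  by (intro borel_measurable_continuous_onI continuous_intros)

lemma space_circle_borel [simp]: "space circle_borel = UNIV"
  and sets_circle_borel [simp, measurable_cong]: "sets circle_borel = sets borel"
  by (simp_all add: circle_borel_def)

lemma emeasure_circle_borel:
  assumes "A \<in> sets borel"
  shows "emeasure circle_borel A = emeasure lborel ({0..<2 * pi} \<inter> cis -` A) / ennreal (2 * pi)"
proof -
  have "cis -` A \<in> sets borel"
    using measurable_sets[OF measurable_cis assms] by simp
  then show ?thesis
    using assms by (simp add: circle_borel_def emeasure_distr)
qed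

lemma emeasure_circle_borel_space: "emeasure circle_borel UNIV = 1"
proof -
  have "ennreal (2 * pi) \<noteq> 0"
    using pi_gt_zero by (simp add: ennreal_eq_0_iff not_le del: pi_gt_zero)
  then show ?thesis
    by (simp add: emeasure_circle_borel ennreal_divide_self)
qed

interpretation circle_borel: finite_measure circle_borel
  by (rule finite_measureI) (simp add: emeasure_circle_borel_space)

lemma AE_circle_borel_norm: "AE z in circle_borel. norm z = 1"
  unfolding circle_borel_def by (subst AE_distr_iff) auto

text \<open>The bridge to \<open>circle_measure\<close>: completion does not change which properties
  hold almost everywhere, and restricting \<open>circle_borel\<close> to the circle gives the
  measure that was completed.\<close>

lemma AE_circle_measure_iff:
  "(AE z in circle_measure. P z) \<longleftrightarrow> (AE z in circle_borel. z \<in> unit_circle \<longrightarrow> P z)"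
proof -
  have "restrict_space circle_borel unit_circle =
    distr (uniform_measure lborel {0..<2 * pi}) (restrict_space borel unit_circle) cis"
  proof (rule measure_eqI)
    fix A assume "A \<in> sets (restrict_space circle_borel unit_circle)"
    then have A: "A \<in> sets borel" "A \<subseteq> unit_circle"
      by (auto simp: sets_restrict_space)
    then have "A \<in> sets (restrict_space borel unit_circle)"
      by (auto simp: sets_restrict_space)
    with A show "emeasure (restrict_space circle_borel unit_circle) A =
      emeasure (distr (uniform_measure lborel {0..<2 * pi}) (restrict_space borel unit_circle) cis) A"
      by (simp add: emeasure_restrict_space emeasure_distr[OF measurable_cis_circle]
        emeasure_distr circle_borel_def)
  qed (simp add: sets_restrict_space)
  then show ?thesis
    unfolding circle_measure_def AE_completion_iff
    by (metis AE_restrict_space_iff borel_closed closed_sphere inf_top.right_neutral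
        sets_circle_borel space_circle_borel)
qed

text \<open>With z = \<open>cis t\<close> one has dz/z = i dt, so a mean over the circle is a
  contour integral divided by 2 pi i. This makes Cauchy's formula available for computing
  moments.\<close>

lemma integral_circle_borel_continuous:
  assumes h[measurable]: "h \<in> borel_measurable borel" and cont: "continuous_on unit_circle h"
    and I: "((\<lambda>z. h z / z) has_contour_integral (2 * of_real pi * \<i> * I)) (circlepath 0 1)"
  shows "(\<integral>z. h z \<partial>circle_borel) = (I :: complex)"
proof -
  have "((\<lambda>t. h (cis t) * \<i>) has_integral (2 * of_real pi * \<i> * I)) {0..2*pi}"
    using I unfolding circlepath_def
    by (subst (asm) has_contour_integral_part_circlepath_iff) (auto simp: mult_ac)
  from has_integral_mult_right[OF this, of "-\<i>"]
  have hi: "((\<lambda>t. h (cis t)) has_integral (2 * of_real pi * I)) {0..2*pi}"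
    by (simp add: algebra_simps)
  have ch: "continuous_on {0..2*pi} (\<lambda>t. h (cis t))"
    by (rule continuous_on_compose2[OF cont]) (auto intro!: continuous_intros)
  have si: "set_integrable lborel {0..2*pi} (\<lambda>t. h (cis t))"
    using borel_integrable_compact[OF _ ch] by (simp add: set_integrable_def)
  have "uniform_measure lborel {0..<2 * pi} =
     density lborel (\<lambda>t. ennreal (indicator {0..<2 * pi} t / (2*pi)))"
    unfolding uniform_measure_def
    by (intro density_cong) (auto split: split_indicator simp: divide_ennreal[symmetric])
  then have "(\<integral>z. h z \<partial>circle_borel) = (\<integral>t. h (cis t) \<partial>density lborel (\<lambda>t. ennreal (indicator {0..<2 * pi} t / (2*pi))))"
    unfolding circle_borel_def by (subst integral_distr) auto
  also have "\<dots> = (\<integral>t. (indicator {0..<2 * pi} t / (2*pi)) *\<^sub>R h (cis t) \<partial>lborel)"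
    by (subst integral_density) auto
  also have "\<dots> = (\<integral>t. (1 / (2*pi)) *\<^sub>R (indicator {0..2 * pi} t *\<^sub>R h (cis t)) \<partial>lborel)"
  proof (rule integral_cong_AE)
    show "AE t in lborel. (indicator {0..<2 * pi} t / (2*pi)) *\<^sub>R h (cis t) =
       (1 / (2*pi)) *\<^sub>R (indicator {0..2 * pi} t *\<^sub>R h (cis t))"
      using AE_lborel_singleton[of "2*pi"] by eventually_elim (auto split: split_indicator)
  qed auto
  also have "\<dots> = (1 / (2*pi)) *\<^sub>R (LINT t:{0..2*pi}|lborel. h (cis t))"
    by (simp only: set_lebesgue_integral_def integral_scaleR_right)
  also have "\<dots> = I"
    using set_borel_integral_eq_integral(2)[OF si] hi
    by (simp add: integral_unique scaleR_conv_of_real)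
  finally show ?thesis .
qed

section \<open>The Poisson kernel: its bound and its moments\<close>

definition poisson_kernel :: "complex \<Rightarrow> complex \<Rightarrow> real" where
  "poisson_kernel a z = (1 - (norm a)\<^sup>2) / (norm (z - a))\<^sup>2"

lemma poisson_kernel_nonneg: "norm a < 1 \<Longrightarrow> 0 \<le> poisson_kernel a z"
  by (simp add: poisson_kernel_def power_le_one)

lemma measurable_poisson_kernel [measurable]: "poisson_kernel a \<in> borel_measurable borel"
  unfolding poisson_kernel_def by measurable

text \<open>Points of the circle have distance at least 1 - |a| from a, which gives the bound (1 +
  |a|) / (1 - |a|). This quotient increases with |a|.\<close>

lemma poisson_kernel_le:
  assumes "norm a \<le> \<alpha>" "\<alpha> < 1" "norm z = 1"
  shows "poisson_kernel a z \<le> (1 + \<alpha>) / (1 - \<alpha>)"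
proof -
  have "1 - norm a \<le> norm (z - a)"
    using norm_triangle_ineq2[of z a] assms by simp
  then have "(1 - norm a)\<^sup>2 \<le> (norm (z - a))\<^sup>2"
    using assms by (intro power_mono) auto
  then have "poisson_kernel a z \<le> (1 - (norm a)\<^sup>2) / (1 - norm a)\<^sup>2"
    unfolding poisson_kernel_def using assms
    by (intro divide_left_mono mult_pos_pos) (auto simp: power_le_one intro: less_le_trans)
  also have "\<dots> = (1 + norm a) / (1 - norm a)"
  proof -
    have "1 - (norm a)\<^sup>2 = (1 + norm a) * (1 - norm a)"
      by (simp add: power2_eq_square algebra_simps)
    then show ?thesis using assms by (simp add: power2_eq_square)
  qed
  also have "\<dots> \<le> (1 + \<alpha>) / (1 - \<alpha>)"
    using assms by (intro frac_le) (use norm_ge_zero[of a] in linarith)+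
  finally show ?thesis .
qed

text \<open>On the circle the kernel equals \<open>z (1 - |a|\<^sup>2) / ((z - a) (1 - cnj a z))\<close>, so that its
  moments are given by Cauchy's integral formula.\<close>

lemma poisson_moment:
  assumes a: "norm a < 1"
  shows "(\<integral>z. poisson_kernel a z *\<^sub>R z ^ m \<partial>circle_borel) = a ^ m"
proof (rule integral_circle_borel_continuous)
  show "continuous_on unit_circle (\<lambda>z. poisson_kernel a z *\<^sub>R z ^ m)"
    unfolding poisson_kernel_def using a by (intro continuous_intros) auto
  define g where "g z = z ^ m * of_real (1 - (norm a)\<^sup>2) / (1 - cnj a * z)" for z :: complex
  have nz: "1 - cnj a * z \<noteq> 0" if "norm z \<le> 1" for z
  proof
    assume "1 - cnj a * z = 0"
    then have "norm a * norm z = 1"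
      by (metis complex_mod_cnj eq_iff_diff_eq_0 norm_mult norm_one)
    moreover have "norm a * norm z \<le> norm a * 1"
      using that by (intro mult_left_mono) auto
    ultimately show False using a by simp
  qed
  have "g holomorphic_on cball 0 1"
    unfolding g_def using nz by (intro holomorphic_intros) auto
  from Cauchy_integral_circlepath_simple[OF this, of a]
  have "((\<lambda>u. g u / (u - a)) has_contour_integral 2 * of_real pi * \<i> * g a) (circlepath 0 1)"
    using a by simp
  moreover have "g a = a ^ m"
    using nz[of a] a by (simp add: g_def complex_norm_square[symmetric] mult.commute)
  moreover have "g z / (z - a) = poisson_kernel a z *\<^sub>R z ^ m / z" if "norm z = 1" for z
  proof -
    have "complex_of_real ((norm (z - a))\<^sup>2) * z = (z - a) * (1 - cnj a * z)"
    proof -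
      have "z * cnj z = 1" using that by (simp add: complex_norm_square[symmetric])
      then show ?thesis unfolding complex_norm_square complex_cnj_diff by algebra
    qed
    moreover have "z \<noteq> 0" "z \<noteq> a" using that a by auto
    ultimately show ?thesis
      using nz[of z] that unfolding g_def poisson_kernel_def scaleR_conv_of_real of_real_divide
      by (simp add: divide_simps)
  qed
  ultimately show "((\<lambda>z. poisson_kernel a z *\<^sub>R z ^ m / z) has_contour_integral
      2 * of_real pi * \<i> * a ^ m) (circlepath 0 1)"
    by (auto elim!: has_contour_integral_eq)
qed measurable

section \<open>Measures on the circle are determined by their moments\<close>

lemma measurable_cnj [measurable]: "cnj \<in> borel_measurable borel"
  by (intro borel_measurable_continuous_onI continuous_intros)

text \<open>On the circle \<open>cnj z\<close> is the inverse of z, so a real polynomial in Re z and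
  Im z becomes a Laurent polynomial. The power of \<open>cnj z\<close> takes the place of negative
  exponents.\<close>

lemma real_polynomial_function_circle:
  fixes p :: "complex \<Rightarrow> real"
  assumes "real_polynomial_function p"
  shows "\<exists>q N. \<forall>z. norm z = 1 \<longrightarrow> of_real (p z) = poly q z * cnj z ^ N"
  using assms
proof induction
  case (linear p)
  \<comment> \<open>Substituting Re z = (z + cnj z) / 2 and Im z = (z - cnj z) / (2i) into Re z p(1)
    + Im z p(i) makes \<open>u\<close> the coefficient of z and \<open>v\<close> that of
    \<open>cnj z\<close>.\<close>
  define u v where "u = of_real (p 1) / 2 + of_real (p \<i>) / (2 * \<i>)"
    and "v = complex_of_real (p 1) / 2 - of_real (p \<i>) / (2 * \<i>)"
  have *: "of_real (p z) = poly [:v, 0, u:] z * cnj z ^ 1" if "norm z = 1" for z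
  proof -
    have 1: "z * cnj z = 1" using that by (simp add: complex_norm_square[symmetric])
    interpret bounded_linear p by fact
    have "p z = p (Re z *\<^sub>R 1 + Im z *\<^sub>R \<i>)"
      by (simp add: scaleR_conv_of_real mult.commute flip: complex_eq)
    also have "\<dots> = Re z * p 1 + Im z * p \<i>"
      by (simp only: add scaleR real_scaleR_def)
    finally have "of_real (p z) = of_real (Re z) * of_real (p 1) + of_real (Im z) * complex_of_real (p \<i>)"
      by simp
    also have "\<dots> = v * cnj z + u * z"
      by (simp add: u_def v_def complex_eq_iff field_simps)
    also have "\<dots> = poly [:v, 0, u:] z * cnj z ^ 1"
      using 1 by (simp add: algebra_simps)
    finally show ?thesis .
  qed
  show ?case using * by blast
next
  case (const c)
  have "of_real c = poly [:of_real c:] z * cnj z ^ 0" for z by simp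
  then show ?case by blast
next
  case (add p p')
  then obtain q N q' N'
    where *: "\<forall>z. norm z = 1 \<longrightarrow> of_real (p z) = poly q z * cnj z ^ N"
      "\<forall>z. norm z = 1 \<longrightarrow> of_real (p' z) = poly q' z * cnj z ^ N'" by blast
  \<comment> \<open>Common denominator: each polynomial is multiplied by the power of z that cancels
    the surplus power of \<open>cnj z\<close>.\<close>
  have "of_real (p z + p' z) = poly (q * monom 1 N' + q' * monom 1 N) z * cnj z ^ (N + N')"
    if "norm z = 1" for z
  proof -
    have "z * cnj z = 1" using that by (simp add: complex_norm_square[symmetric])
    then have "z ^ k * cnj z ^ k = 1" for k
      by (simp flip: power_mult_distrib)
    from this[of N] this[of N']
    have "poly q z * cnj z ^ N + poly q' z * cnj z ^ N' =
      (poly q z * z ^ N' + poly q' z * z ^ N) * (cnj z ^ N * cnj z ^ N')"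
    proof -
      have "x * b + y * d = (x * c + y * a) * (b * d)"
        if "a * b = 1" "c * d = 1" for a b c d x y :: complex
        using that by algebra
      then show ?thesis using \<open>z ^ N * cnj z ^ N = 1\<close> \<open>z ^ N' * cnj z ^ N' = 1\<close> .
    qed
    then show ?thesis
      using * that by (simp add: poly_monom power_add)
  qed
  then show ?case by blast
next
  case (mult p p')
  then obtain q N q' N'
    where *: "\<forall>z. norm z = 1 \<longrightarrow> of_real (p z) = poly q z * cnj z ^ N"
      "\<forall>z. norm z = 1 \<longrightarrow> of_real (p' z) = poly q' z * cnj z ^ N'" by blast
  have "of_real (p z * p' z) = poly (q * q') z * cnj z ^ (N + N')" if "norm z = 1" for z
    using * that by (simp add: power_add)
  then show ?case by blast
qed

lemma (in finite_measure) integrable_bounded_AE: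
  fixes f :: "'a \<Rightarrow> 'b :: {banach, second_countable_topology}"
  assumes "f \<in> borel_measurable M" "AE x in M. norm (f x) \<le> B"
  shows "integrable M f"
  using integrable_const_bound assms by blast

text \<open>Because z * cnj z = 1, the common factors cancel and a plain power or the conjugate of
  one is left. Hence the moments with nonnegative exponents already determine those with negative
  ones.\<close>

lemma integral_power_cnj_power_circle:
  assumes M: "sets M = sets borel" "AE z in M. norm z = 1"
  shows "(\<integral>z. z ^ j * cnj z ^ k \<partial>M) =
    (if k \<le> j then \<integral>z. z ^ (j - k) \<partial>M else cnj (\<integral>z. z ^ (k - j) \<partial>M))"
proof -
  note [measurable_cong] = M(1)
  have 1: "z ^ (k + d) * cnj z ^ k = z ^ d" if "norm z = 1" for z d and k :: nat
  proof -
    have "z * cnj z = 1" using that by (simp add: complex_norm_square[symmetric])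
    then have "z ^ k * cnj z ^ k = 1"
      by (simp flip: power_mult_distrib)
    then show ?thesis by (simp add: power_add mult_ac)
  qed
  show ?thesis
  proof (cases "k \<le> j")
    case True
    have "AE z in M. z ^ j * cnj z ^ k = z ^ (j - k)"
      using M(2)
    proof eventually_elim
      case (elim z)
      then show ?case using 1[of z k "j - k"] True by simp
    qed
    then have "(\<integral>z. z ^ j * cnj z ^ k \<partial>M) = (\<integral>z. z ^ (j - k) \<partial>M)"
      by (intro integral_cong_AE) measurable
    then show ?thesis using True by simp
  next
    case False
    have "AE z in M. z ^ j * cnj z ^ k = cnj (z ^ (k - j))"
      using M(2)
    proof eventually_elim
      case (elim z)
      then show ?case using arg_cong[OF 1[of z j "k - j"], of cnj] False by (simp add: mult.commute)
    qed
    then have "(\<integral>z. z ^ j * cnj z ^ k \<partial>M) = (\<integral>z. cnj (z ^ (k - j)) \<partial>M)"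
      by (intro integral_cong_AE) measurable
    also have "\<dots> = cnj (\<integral>z. z ^ (k - j) \<partial>M)"
      by (rule Bochner_Integration.integral_cnj)
    finally show ?thesis using False by simp
  qed
qed

text \<open>The moments give the integrals of all real polynomials. Stone-Weierstrass extends the
  equality to continuous functions, dominated convergence to open sets, and the open sets are an
  intersection-stable generator of the Borel sets.\<close>

lemma circle_measure_eqI_moments:
  fixes M N :: "complex measure"
  assumes "finite_measure M" "finite_measure N"
    and sets: "sets M = sets borel" "sets N = sets borel"
    and circle: "AE z in M. norm z = 1" "AE z in N. norm z = 1"
    and moments: "\<And>m. (\<integral>z. z ^ m \<partial>M) = (\<integral>z. z ^ m \<partial>N)"
  shows "M = N"
proof -
  interpret M: finite_measure M by fact
  interpret N: finite_measure N by fact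
  note [measurable_cong] = sets
  have jk: "(\<integral>z. z ^ j * cnj z ^ k \<partial>M) = (\<integral>z. z ^ j * cnj z ^ k \<partial>N)" for j k
    using sets circle by (simp add: integral_power_cnj_power_circle moments)
  have poly_exp: "(\<integral>z. poly q z * cnj z ^ k \<partial>K) =
      (\<Sum>j\<le>degree q. coeff q j * (\<integral>z. z ^ j * cnj z ^ k \<partial>K))"
    if K: "finite_measure K" "sets K = sets borel" "AE z in K. norm z = 1" for K q k
  proof -
    interpret K: finite_measure K by fact
    note [measurable_cong] = K(2)
    have "integrable K (\<lambda>z. z ^ j * cnj z ^ k)" for j
      using K(3) by (intro K.integrable_bounded_AE[where B=1])
        (auto elim!: eventually_mono simp: norm_mult norm_power)
    then show ?thesis
      by (simp add: poly_altdef sum_distrib_right mult.assoc)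
  qed
  have poly_eq: "(\<integral>z. p z \<partial>M) = (\<integral>z. p z \<partial>N)"
    if p: "real_polynomial_function p" for p
  proof -
    obtain q k where q: "\<And>z. norm z = 1 \<Longrightarrow> of_real (p z) = poly q z * cnj z ^ k"
      using real_polynomial_function_circle[OF p] by blast
    have [measurable]: "p \<in> borel_measurable borel"
      using p by (intro borel_measurable_continuous_onI continuous_real_polymonial_function continuous_at_imp_continuous_on ballI)
    have [measurable]: "poly q \<in> borel_measurable borel"
      by (intro borel_measurable_continuous_onI continuous_intros)
    have *: "complex_of_real (\<integral>z. p z \<partial>K) = (\<integral>z. poly q z * cnj z ^ k \<partial>K)"
      if "sets K = sets borel" "AE z in K. norm z = 1" for K
    proof -
      note [measurable_cong] = that(1)
      have "complex_of_real (\<integral>z. p z \<partial>K) = (\<integral>z. complex_of_real (p z) \<partial>K)"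
        by simp
      also have "\<dots> = (\<integral>z. poly q z * cnj z ^ k \<partial>K)"
        using that(2) q by (intro integral_cong_AE) (auto elim!: eventually_mono)
      finally show ?thesis .
    qed
    have "complex_of_real (\<integral>z. p z \<partial>M) = of_real (\<integral>z. p z \<partial>N)"
      using assms jk by (simp only: * poly_exp)
    then show ?thesis by (simp only: of_real_eq_iff)
  qed
  have cont_eq: "(\<integral>z. h z \<partial>M) = (\<integral>z. h z \<partial>N)"
    if h: "continuous_on UNIV h" for h :: "complex \<Rightarrow> real"
  proof -
    have [measurable]: "h \<in> borel_measurable borel"
      using h by (rule borel_measurable_continuous_onI)
    have "bounded (h ` unit_circle)"
      using h by (intro compact_imp_bounded compact_continuous_image) (auto intro: continuous_on_subset)
    then obtain B where "\<forall>x\<in>h ` unit_circle. norm x \<le> B"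
      unfolding bounded_iff by blast
    then have B: "norm (h z) \<le> B" if "norm z = 1" for z
      using that by auto
    define C where "C = measure M UNIV + measure N UNIV"
    have "\<bar>(\<integral>z. h z \<partial>M) - (\<integral>z. h z \<partial>N)\<bar> \<le> e * C" if e: "e > 0" for e
    proof -
      obtain p where p: "real_polynomial_function p" "\<And>z. z \<in> sphere 0 1 \<Longrightarrow> \<bar>h z - p z\<bar> < e"
        using Stone_Weierstrass_real_polynomial_function[OF compact_sphere continuous_on_subset[OF h] e]
        by blast
      have [measurable]: "p \<in> borel_measurable borel"
        using p by (intro borel_measurable_continuous_onI continuous_real_polymonial_function continuous_at_imp_continuous_on ballI)
      have *: "\<bar>(\<integral>z. h z \<partial>K) - (\<integral>z. p z \<partial>K)\<bar> \<le> e * measure K UNIV"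
        if K: "finite_measure K" "sets K = sets borel" "AE z in K. norm z = 1" for K
      proof -
        interpret K: finite_measure K by fact
        note [measurable_cong] = K(2)
        have "space K = UNIV" using sets_eq_imp_space_eq[OF K(2)] by simp
        have bd: "AE z in K. \<bar>h z - p z\<bar> \<le> e"
          using K(3) p(2) by (auto elim!: eventually_mono intro: less_imp_le)
        have ih: "integrable K h" using K(3) B by (intro K.integrable_bounded_AE[where B=B]) (auto elim!: eventually_mono)
        have id: "integrable K (\<lambda>z. h z - p z)"
          using bd by (intro K.integrable_bounded_AE[where B=e]) auto
        have ip: "integrable K p"
          using Bochner_Integration.integrable_diff[OF ih id] by simp
        have "\<bar>(\<integral>z. h z \<partial>K) - (\<integral>z. p z \<partial>K)\<bar> = \<bar>\<integral>z. h z - p z \<partial>K\<bar>"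
          using ih ip by simp
        also have "\<dots> \<le> (\<integral>z. \<bar>h z - p z\<bar> \<partial>K)" by (rule integral_abs_bound)
        also have "\<dots> \<le> (\<integral>z. e \<partial>K)"
          using bd id by (intro integral_mono_AE) auto
        finally show ?thesis using \<open>space K = UNIV\<close> by (simp add: mult.commute)
      qed
      have "\<bar>(\<integral>z. h z \<partial>M) - (\<integral>z. p z \<partial>M)\<bar> \<le> e * measure M UNIV"
        "\<bar>(\<integral>z. h z \<partial>N) - (\<integral>z. p z \<partial>N)\<bar> \<le> e * measure N UNIV"
        using assms by (auto intro!: *)
      then show ?thesis
        using poly_eq[OF p(1)] unfolding C_def distrib_left by linarith
    qed
    note bound = this
    have "\<bar>(\<integral>z. h z \<partial>M) - (\<integral>z. h z \<partial>N)\<bar> \<le> 0 + e" if "e > 0" for e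
    proof -
      have C: "C \<ge> 0" by (simp add: C_def)
      \<comment> \<open>The total mass \<open>C\<close> may be 0, hence the division by
        \<open>C + 1\<close>.\<close>
      have "e / (C + 1) > 0" using that C by simp
      from bound[OF this] have "\<bar>(\<integral>z. h z \<partial>M) - (\<integral>z. h z \<partial>N)\<bar> \<le> e / (C + 1) * C" .
      also have "\<dots> \<le> e" using that C by (simp add: field_simps)
      finally show ?thesis by simp
    qed
    then have "\<bar>(\<integral>z. h z \<partial>M) - (\<integral>z. h z \<partial>N)\<bar> \<le> 0" by (rule field_le_epsilon)
    then show ?thesis by simp
  qed
  have open_eq: "emeasure M U = emeasure N U" if U: "open U" for U
  proof -
    \<comment> \<open>Continuous functions increasing to the indicator of \<open>U\<close>. The
      whole plane is treated apart because \<open>infdist\<close> to the empty set is 0 by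
      convention.\<close>
    define h where "h j z = (if U = UNIV then 1 else min 1 (real j * infdist z (-U)))" for j z
    have hU: "(\<lambda>j. h j z) \<longlonglongrightarrow> indicator U z" for z
    proof (cases "U = UNIV")
      case False
      then have ne: "-U \<noteq> {}" by auto
      show ?thesis
      proof (cases "z \<in> U")
        case True
        then have pos: "infdist z (-U) > 0"
          using ne U by (simp add: infdist_pos_not_in_closed closed_Compl)
        obtain m :: nat where m: "1 < real m * infdist z (-U)"
          using reals_Archimedean3[OF pos] by blast
        have "\<forall>\<^sub>F j in sequentially. h j z = 1"
          using eventually_ge_at_top[of m]
        proof eventually_elim
          case (elim j)
          then have "real m * infdist z (-U) \<le> real j * infdist z (-U)"
            using pos by (intro mult_right_mono) auto
          then show ?case using m False by (simp add: h_def)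
        qed
        then show ?thesis using True by (simp add: tendsto_eventually)
      qed (use False in \<open>simp add: h_def\<close>)
    qed (simp add: h_def)
    have hc: "continuous_on UNIV (h j)" for j
      unfolding h_def by (cases "U = UNIV") (auto intro!: continuous_intros)
    have hb: "\<bar>h j z\<bar> \<le> 1" for j z
      by (auto simp: h_def infdist_nonneg)
    have lim: "(\<lambda>j. \<integral>z. h j z \<partial>K) \<longlonglongrightarrow> measure K U"
      if K: "finite_measure K" "sets K = sets borel" for K
    proof -
      interpret K: finite_measure K by fact
      note [measurable_cong] = K(2)
      have [measurable]: "U \<in> sets borel" using U by simp
      have [measurable]: "h j \<in> borel_measurable borel" for j
        using hc by (rule borel_measurable_continuous_onI)
      have "(\<lambda>j. \<integral>z. h j z \<partial>K) \<longlonglongrightarrow> (\<integral>z. indicator U z \<partial>K)"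
        by (rule integral_dominated_convergence[where w="\<lambda>_. 1"]) (auto simp: hU hb)
      then show ?thesis
        using K sets_eq_imp_space_eq[OF K(2)] by simp
    qed
    have "measure M U = measure N U"
      using LIMSEQ_unique[OF lim[OF assms(1) sets(1)]] lim[OF assms(2) sets(2)] by (simp add: cont_eq[OF hc])
    then show ?thesis
      by (simp add: M.emeasure_eq_measure N.emeasure_eq_measure)
  qed
  show ?thesis
    by (rule measure_eqI_generator_eq[where E="{S. open S}" and \<Omega>=UNIV and A="\<lambda>_. UNIV"])
      (auto simp: Int_stable_def open_eq sets borel_def)
qed

section \<open>Power series at the origin and radial limits\<close>

lemma filterlim_at_left_one:
  "filterlim (\<lambda>i. 1 - inverse (real (Suc i))) (at_left 1) sequentially"
proof (rule tendsto_imp_filterlim_at_left)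
  show "(\<lambda>i. 1 - inverse (real (Suc i))) \<longlonglongrightarrow> 1"
    using LIMSEQ_inverse_real_of_nat_add_minus[of 1] by simp
qed auto

lemma has_radial_limit_sequentially:
  assumes "has_radial_limit f z w"
  shows "(\<lambda>i. f (of_real (1 - inverse (real (Suc i))) * z)) \<longlonglongrightarrow> w"
  using filterlim_compose[OF assms[unfolded has_radial_limit_def] filterlim_at_left_one] .

text \<open>The \<open>c k\<close> are the Taylor coefficients of (f(z) / z)^m, whose singularity at
  0 is removable because f(0) = 0. Multiplying by z^m shifts the exponents, so the expansion of f^m
  starts at degree m.\<close>

lemma holomorphic_disk_power_series:
  assumes "f holomorphic_on unit_disk" "f 0 = 0"
  obtains c where "c 0 = deriv f 0 ^ m"
    and "\<And>z. norm z < 1 \<Longrightarrow> (\<lambda>k. c k * z ^ (k + m)) sums (f z ^ m)"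
    and "\<And>t. 0 \<le> t \<Longrightarrow> t < 1 \<Longrightarrow> summable (\<lambda>k. norm (c k) * t ^ k)"
proof -
  define g where "g z = (if z = 0 then deriv f 0 else f z / z)" for z
  have "g holomorphic_on unit_disk"
    using pole_lemma_open[OF assms(1) open_ball, of 0]
    by (rule holomorphic_transform) (simp add: g_def assms(2))
  then have "(\<lambda>z. g z ^ m) holomorphic_on unit_disk"
    by (intro holomorphic_intros)
  note ps = holomorphic_power_series[OF this, simplified]
  define c where "c k = (deriv ^^ k) (\<lambda>z. g z ^ m) 0 / fact k" for k
  have sums: "(\<lambda>k. c k * z ^ k) sums (g z ^ m)" if "norm z < 1" for z
    using ps[of z] that unfolding c_def by simp
  have "(\<lambda>k. c k * z ^ (k + m)) sums (f z ^ m)" if "norm z < 1" for z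
  proof -
    have "f z = z * g z" using assms(2) by (simp add: g_def)
    then show ?thesis
      using sums_mult[OF sums[OF that], of "z ^ m"]
      by (simp add: power_mult_distrib power_add mult_ac)
  qed
  moreover have "summable (\<lambda>k. norm (c k) * t ^ k)" if "0 \<le> t" "t < 1" for t
  proof -
    \<comment> \<open>The midpoint of t and 1 is still inside the disk. Convergence there forces
      absolute convergence at the smaller radius t.\<close>
    have "summable (\<lambda>k. c k * of_real ((1 + t) / 2) ^ k)"
      using sums[of "of_real ((1 + t) / 2)"] that by (simp add: sums_iff flip: of_real_add)
    from powser_insidea[OF this, of "of_real t"] show ?thesis
      using that by (simp add: norm_mult norm_power flip: of_real_add)
  qed
  moreover have "c 0 = deriv f 0 ^ m" by (simp add: c_def g_def)
  ultimately show ?thesis using that by blast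
qed

text \<open>On the circle of radius \<open>t < 1\<close>, expand \<open>f(tX)\<^sup>m\<close> into its power series, which starts at
  degree \<open>m\<close>: the orthogonality hypothesis kills all other terms. Then let \<open>t \<rightarrow> 1\<close>.\<close>

lemma (in finite_measure) integral_radial_limit_power:
  fixes f :: "complex \<Rightarrow> complex"
  assumes f: "f holomorphic_on unit_disk" "f ` unit_disk \<subseteq> unit_disk" "f 0 = 0"
    and [measurable]: "X \<in> borel_measurable M" "Y \<in> borel_measurable M" "W \<in> borel_measurable M"
    and X: "AE x in M. norm (X x) = 1" and W: "AE x in M. norm (W x) \<le> 1"
    and lim: "AE x in M. has_radial_limit f (X x) (Y x)"
    and orth: "\<And>j. j > m \<Longrightarrow> (\<integral>x. X x ^ j * W x \<partial>M) = 0"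
  shows "(\<integral>x. Y x ^ m * W x \<partial>M) = deriv f 0 ^ m * (\<integral>x. X x ^ m * W x \<partial>M)"
proof -
  obtain c where c0: "c 0 = deriv f 0 ^ m"
    and sums: "\<And>z. norm z < 1 \<Longrightarrow> (\<lambda>k. c k * z ^ (k + m)) sums (f z ^ m)"
    and summ: "\<And>t. 0 \<le> t \<Longrightarrow> t < 1 \<Longrightarrow> summable (\<lambda>k. norm (c k) * t ^ k)"
    using holomorphic_disk_power_series[OF f(1,3)] by metis
  define t where "t i = 1 - inverse (real (Suc i))" for i
  have t: "0 \<le> t i" "t i < 1" for i
    by (auto simp: t_def field_simps)
  have t1: "t \<longlonglongrightarrow> 1"
    using filterlim_at_left_one unfolding t_def filterlim_at by simp
  define s where "s i x = (\<Sum>k. c k * of_real (t i) ^ (k + m) * (X x ^ (k + m) * W x))" for i x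
  have [measurable]: "s i \<in> borel_measurable M" for i
    unfolding s_def by measurable
  have int_XW: "integrable M (\<lambda>x. X x ^ j * W x)" for j
  proof (rule integrable_bounded_AE)
    show "AE x in M. norm (X x ^ j * W x) \<le> 1"
      using X W by eventually_elim (simp add: norm_mult norm_power)
  qed measurable
  have s_eq: "AE x in M. \<forall>i. s i x = f (of_real (t i) * X x) ^ m * W x"
    using X
  proof eventually_elim
    case (elim x)
    show ?case
    proof
      fix i
      have "norm (of_real (t i) * X x) < 1" using t elim by (simp add: norm_mult)
      from sums_mult2[OF sums[OF this], of "W x"]
      show "s i x = f (of_real (t i) * X x) ^ m * W x"
        unfolding s_def by (simp add: power_mult_distrib sums_iff mult.assoc)
    qed
  qed
  have int_s: "(\<integral>x. s i x \<partial>M) = of_real (t i) ^ m * (deriv f 0 ^ m * (\<integral>x. X x ^ m * W x \<partial>M))" for i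
  proof -
    let ?F = "\<lambda>k x. c k * of_real (t i) ^ (k + m) * (X x ^ (k + m) * W x)"
    \<comment> \<open>This bound does not depend on x and is summable in k, which permits exchanging
      series and integral.\<close>
    have le: "norm (?F k x) \<le> norm (c k) * t i ^ k" if "norm (X x) = 1" "norm (W x) \<le> 1" for k x
    proof -
      have "norm (?F k x) = norm (c k) * t i ^ k * (t i ^ m * norm (W x))"
        using t that by (simp add: norm_mult norm_power power_add mult_ac)
      also have "\<dots> \<le> norm (c k) * t i ^ k * (1 * 1)"
        using t[of i] that by (intro mult_left_mono mult_mono power_le_one) auto
      finally show ?thesis by simp
    qed
    have int_F: "integrable M (?F k)" for k
      using int_XW by simp
    have "(\<lambda>k. \<integral>x. ?F k x \<partial>M) sums (\<integral>x. s i x \<partial>M)"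
      unfolding s_def
    proof (rule sums_integral[OF int_F])
      show "AE x in M. summable (\<lambda>k. norm (?F k x))"
        using X W
      proof eventually_elim
        case (elim x)
        then show ?case
          by (intro summable_comparison_test'[OF summ[OF t[of i]]]) (simp add: le del: norm_mult)
      qed
      have "(\<integral>x. norm (?F k x) \<partial>M) \<le> norm (c k) * t i ^ k * measure M (space M)" for k
      proof -
        have "(\<integral>x. norm (?F k x) \<partial>M) \<le> (\<integral>x. norm (c k) * t i ^ k \<partial>M)"
        proof (rule integral_mono_AE)
          show "AE x in M. norm (?F k x) \<le> norm (c k) * t i ^ k"
            using X W by eventually_elim (rule le)
        qed (use int_F in \<open>auto intro: integrable_norm\<close>)
        then show ?thesis by (simp add: mult_ac)
      qed
      then show "summable (\<lambda>k. \<integral>x. norm (?F k x) \<partial>M)"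
        by (intro summable_comparison_test'[OF summable_mult2[OF summ[OF t[of i]], of "measure M (space M)"]]) simp
    qed
    moreover have "(\<integral>x. ?F k x \<partial>M) = 0" if "k \<noteq> 0" for k
      using that orth[of "k + m"] by simp
    then have "(\<lambda>k. \<integral>x. ?F k x \<partial>M) sums (\<integral>x. ?F 0 x \<partial>M)"
      using sums_single[of 0 "\<lambda>k. \<integral>x. ?F k x \<partial>M"]
      by (auto elim!: back_subst[of "\<lambda>g. g sums _"])
    ultimately have "(\<integral>x. s i x \<partial>M) = (\<integral>x. ?F 0 x \<partial>M)"
      using sums_unique2 by blast
    also have "(\<lambda>x. ?F 0 x) = (\<lambda>x. (of_real (t i) ^ m * deriv f 0 ^ m) * (X x ^ m * W x))"
      by (simp add: c0 mult_ac)
    finally show ?thesis by (simp add: mult.assoc)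
  qed
  \<comment> \<open>As f maps the disk into itself, the constant 1 dominates the integrands at every
    radius.\<close>
  have "(\<lambda>i. \<integral>x. s i x \<partial>M) \<longlonglongrightarrow> (\<integral>x. Y x ^ m * W x \<partial>M)"
  proof (rule integral_dominated_convergence[where w="\<lambda>_. 1"])
    show "AE x in M. (\<lambda>i. s i x) \<longlonglongrightarrow> Y x ^ m * W x"
      using s_eq lim
    proof eventually_elim
      case (elim x)
      have "(\<lambda>i. f (of_real (t i) * X x)) \<longlonglongrightarrow> Y x"
        unfolding t_def by (rule has_radial_limit_sequentially) (use elim in simp)
      then show ?case using elim(1) by (auto intro!: tendsto_intros)
    qed
    show "AE x in M. norm (s i x) \<le> 1" for i
      using s_eq X W
    proof eventually_elim
      case (elim x)
      have "of_real (t i) * X x \<in> unit_disk"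
        using t[of i] elim by (simp add: norm_mult)
      then have "norm (f (of_real (t i) * X x)) \<le> 1"
        using f(2) by (auto simp: subset_iff less_imp_le)
      then have "norm (f (of_real (t i) * X x)) ^ m * norm (W x) \<le> 1 * 1"
        using elim by (intro mult_mono power_le_one) auto
      then show ?case using elim by (simp add: norm_mult norm_power)
    qed
  qed auto
  moreover have "(\<lambda>i. \<integral>x. s i x \<partial>M) \<longlonglongrightarrow> of_real 1 ^ m * (deriv f 0 ^ m * (\<integral>x. X x ^ m * W x \<partial>M))"
    unfolding int_s by (intro tendsto_intros t1)
  ultimately show ?thesis
    using LIMSEQ_unique by fastforce
qed

section \<open>Laws and mixed moments of the composed boundary maps\<close>

lemma circle_borel_moment: "(\<integral>z. z ^ m \<partial>circle_borel) = 0 ^ m"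
proof -
  have "(\<integral>z. z ^ m \<partial>circle_borel) = (\<integral>z. poisson_kernel 0 z *\<^sub>R z ^ m \<partial>circle_borel)"
    using AE_circle_borel_norm
    by (intro integral_cong_AE) (auto elim!: eventually_mono simp: poisson_kernel_def)
  then show ?thesis by (simp add: poisson_moment)
qed

lemma distr_circle_borel_eqI:
  fixes X :: "complex \<Rightarrow> complex"
  assumes [measurable]: "X \<in> borel_measurable borel"
    and X: "AE z in circle_borel. norm (X z) = 1"
    and moments: "\<And>m. (\<integral>z. X z ^ m \<partial>circle_borel) = (\<integral>z. z ^ m \<partial>N)"
    and N: "finite_measure N" "sets N = sets borel" "AE z in N. norm z = 1"
  shows "distr circle_borel borel X = N"
proof (rule circle_measure_eqI_moments)
  show "finite_measure (distr circle_borel borel X)"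
    by (intro circle_borel.finite_measure_distr) measurable
  show "AE z in distr circle_borel borel X. norm z = 1"
    using X by (subst AE_distr_iff) auto
  show "(\<integral>z. z ^ m \<partial>distr circle_borel borel X) = (\<integral>z. z ^ m \<partial>N)" for m
    by (subst integral_distr) (auto simp: moments)
qed (use N in auto)

text \<open>\<open>boundary_map\<close> is partial and picks its values by \<open>THE\<close>. For
  integration it is replaced by a total Borel function, the pointwise limit of the dilates z -> f(t
  z) along a sequence of radii t tending to 1.\<close>

lemma inner_function_boundary_map_measurable:
  assumes "inner_function f"
  obtains g where "g \<in> borel_measurable borel"
    and "AE z in circle_borel. boundary_map f z = Some (g z)"
proof -
  define t where "t i = 1 - inverse (real (Suc i))" for i
  have t: "0 \<le> t i" "t i < 1" for i
    by (auto simp: t_def field_simps)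
  \<comment> \<open>Off the circle the dilated point can leave the disk, where nothing is known
    about \<open>f\<close>. The indicator removes these values.\<close>
  define h where "h i z = indicator unit_circle z *\<^sub>R f (of_real (t i) * z)" for i z
  have [measurable]: "h i \<in> borel_measurable borel" for i
    unfolding h_def
  proof (rule borel_measurable_continuous_on_indicator)
    have "continuous_on unit_disk f"
      using assms by (auto simp: inner_function_def intro: holomorphic_on_imp_continuous_on)
    then show "continuous_on unit_circle (\<lambda>z. f (of_real (t i) * z))"
      by (rule continuous_on_compose2) (use t[of i] in \<open>auto intro!: continuous_intros simp: norm_mult\<close>)
  qed simp
  have "AE z in circle_borel. z \<in> unit_circle \<longrightarrow> (\<exists>w\<in>unit_circle. has_radial_limit f z w)"
    using assms unfolding inner_function_def AE_circle_measure_iff by blast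
  then have "AE z in circle_borel. boundary_map f z = Some (lim (\<lambda>i. h i z))"
    using AE_circle_borel_norm
  proof eventually_elim
    case (elim z)
    then obtain w where w: "norm w = 1" "has_radial_limit f z w" by auto
    have "(\<lambda>i. h i z) \<longlonglongrightarrow> w"
      using has_radial_limit_sequentially[OF w(2)] elim by (simp add: h_def t_def)
    then have "lim (\<lambda>i. h i z) = w" by (rule limI)
    then show ?case using w elim by (simp add: boundary_map_eq_Some_iff)
  qed
  moreover have "(\<lambda>z. lim (\<lambda>i. h i z)) \<in> borel_measurable borel" by measurable
  ultimately show ?thesis using that by blast
qed

text \<open>The range \<open>k \<le> j\<close> is what the induction needs. The moments with k = 0
  show that \<open>X\<close> preserves the measure, so the next boundary map is defined at
  \<open>X z\<close> for almost every z. The vanishing for j > k is the orthogonality required by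
  the next radial limit. The diagonal j = k gives the moments of X(z) / z.\<close>

lemma boundary_iter_moments:
  fixes f :: "nat \<Rightarrow> complex \<Rightarrow> complex"
  assumes inner: "\<And>n. n \<ge> 1 \<Longrightarrow> inner_function (f n)"
    and centred: "\<And>n. n \<ge> 1 \<Longrightarrow> f n 0 = 0"
  shows "\<exists>X \<in> borel_measurable borel.
    (AE z in circle_borel. norm (X z) = 1 \<and> boundary_iter f n z = Some (X z)) \<and>
    (\<forall>j k. k \<le> j \<longrightarrow> (\<integral>z. X z ^ j * cnj z ^ k \<partial>circle_borel) =
      (if j = k then (\<Prod>i=1..n. deriv (f i) 0) ^ k else 0))"
proof (induction n)
  case 0
  show ?case
    using AE_circle_borel_norm
    by (intro bexI[of _ "\<lambda>z. z"])
      (auto simp: integral_power_cnj_power_circle circle_borel_moment)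
next
  case (Suc n)
  then obtain X where [measurable]: "X \<in> borel_measurable borel"
    and X: "AE z in circle_borel. norm (X z) = 1 \<and> boundary_iter f n z = Some (X z)"
    and mom: "\<And>j k. k \<le> j \<Longrightarrow> (\<integral>z. X z ^ j * cnj z ^ k \<partial>circle_borel) =
      (if j = k then (\<Prod>i=1..n. deriv (f i) 0) ^ k else 0)" by blast
  have normX: "AE z in circle_borel. norm (X z) = 1"
    using X by (auto elim: eventually_mono)
  have inn: "inner_function (f (Suc n))" using inner by simp
  obtain g where [measurable]: "g \<in> borel_measurable borel"
    and g: "AE z in circle_borel. boundary_map (f (Suc n)) z = Some (g z)"
    using inner_function_boundary_map_measurable[OF inn] .
  have "(\<integral>z. X z ^ m \<partial>circle_borel) = (\<integral>z. z ^ m \<partial>circle_borel)" for m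
    using mom[of 0 m] by (auto simp: circle_borel_moment)
  then have law: "distr circle_borel borel X = circle_borel"
    using normX AE_circle_borel_norm by (intro distr_circle_borel_eqI) (auto intro: circle_borel.finite_measure_axioms)
  \<comment> \<open>The exceptional null set of the next boundary map has a null preimage under
    \<open>X\<close>, because the law of \<open>X\<close> is again
    \<open>circle_borel\<close>.\<close>
  from g have "AE z in distr circle_borel borel X. boundary_map (f (Suc n)) z = Some (g z)"
    unfolding law .
  then have "AE z in circle_borel. boundary_map (f (Suc n)) (X z) = Some (g (X z))"
    by (rule AE_distrD[rotated]) simp
  with X have Y: "AE z in circle_borel. norm (g (X z)) = 1 \<and> has_radial_limit (f (Suc n)) (X z) (g (X z))
      \<and> boundary_iter f (Suc n) z = Some (g (X z))"
  proof eventually_elim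
    case (elim z)
    then show ?case using boundary_map_eq_Some_iff[of "f (Suc n)" "X z" "g (X z)"]
      by (simp add: map_comp_def)
  qed
  have "(\<integral>z. g (X z) ^ j * cnj z ^ k \<partial>circle_borel) =
      deriv (f (Suc n)) 0 ^ j * (\<integral>z. X z ^ j * cnj z ^ k \<partial>circle_borel)" if "k \<le> j" for j k
  proof (rule circle_borel.integral_radial_limit_power)
    show "AE z in circle_borel. norm (cnj z ^ k) \<le> 1"
      using AE_circle_borel_norm by (auto elim!: eventually_mono simp: norm_power)
    show "AE z in circle_borel. has_radial_limit (f (Suc n)) (X z) (g (X z))"
      using Y by (auto elim: eventually_mono)
    show "(\<integral>z. X z ^ i * cnj z ^ k \<partial>circle_borel) = 0" if "i > j" for i
      using mom[of k i] that \<open>k \<le> j\<close> by simp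
  qed (use inn centred normX in \<open>auto simp: inner_function_def\<close>)
  then have "\<forall>j k. k \<le> j \<longrightarrow> (\<integral>z. g (X z) ^ j * cnj z ^ k \<partial>circle_borel) =
      (if j = k then (\<Prod>i=1..Suc n. deriv (f i) 0) ^ k else 0)"
    using mom by (simp add: power_mult_distrib)
  with Y show ?case
    by (intro bexI[of _ "\<lambda>z. g (X z)"]) (auto elim: eventually_mono)
qed

section \<open>Arcs, balls and the size of return sets\<close>

lemma emeasure_arc_le:
  assumes "0 < \<rho>"
  shows "emeasure circle_borel (cis ` {-2*pi*\<rho>..2*pi*\<rho>}) \<le> ennreal (2 * \<rho>)"
proof (cases "\<rho> < 1/2")
  case True
  let ?K = "cis ` {-2*pi*\<rho>..2*pi*\<rho>}"
  have "compact ?K"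
    by (intro compact_continuous_image continuous_intros) auto
  then have K: "?K \<in> sets borel" by (simp add: borel_compact)
  \<comment> \<open>The arc about 1 appears in one period as two intervals, one at each end. Since
    \<rho> < 1/2, angles with the same \<open>cis\<close> can differ here only by 0 or by 2
    pi.\<close>
  have "{0..<2 * pi} \<inter> cis -` ?K \<subseteq> {0..2*pi*\<rho>} \<union> {2*pi - 2*pi*\<rho>..2*pi}"
  proof
    fix x assume "x \<in> {0..<2 * pi} \<inter> cis -` ?K"
    then obtain s where x: "0 \<le> x" "x < 2 * pi" and s: "-2*pi*\<rho> \<le> s" "s \<le> 2*pi*\<rho>"
      and eq: "cis x = cis s" by auto
    have "sin x = sin s \<and> cos x = cos s"
      using eq by (simp add: complex_eq_iff)
    then obtain k where k: "x = s + 2 * pi * of_int k"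
      unfolding sin_cos_eq_iff by blast
    have "2*pi*\<rho> < pi" using True by simp
    then have "2 * pi * of_int k > 2 * pi * (-1)" "2 * pi * of_int k < 2 * pi * 2"
      using x s k by linarith+
    then have "real_of_int k > -1" "real_of_int k < 2"
      by (simp_all only: mult_less_cancel_left_pos[of "2*pi"] pi_gt_zero mult_pos_pos zero_less_numeral)
    then have "k = 0 \<or> k = 1" by linarith
    then show "x \<in> {0..2*pi*\<rho>} \<union> {2*pi - 2*pi*\<rho>..2*pi}"
      using x s k by auto
  qed
  then have "emeasure lborel ({0..<2 * pi} \<inter> cis -` ?K) \<le>
      emeasure lborel ({0..2*pi*\<rho>} \<union> {2*pi - 2*pi*\<rho>..2*pi})"
    by (intro emeasure_mono) auto
  also have "\<dots> \<le> emeasure lborel {0..2*pi*\<rho>} + emeasure lborel {2*pi - 2*pi*\<rho>..2*pi}"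
    by (intro emeasure_subadditive) auto
  also have "\<dots> = ennreal (2 * pi * (2 * \<rho>))"
    using assms by (simp flip: ennreal_plus)
  finally have "emeasure circle_borel ?K \<le> ennreal (2 * pi * (2 * \<rho>)) / ennreal (2 * pi)"
    unfolding emeasure_circle_borel[OF K] by (rule divide_right_mono_ennreal)
  also have "\<dots> = ennreal (2 * \<rho>)"
    using assms by (simp add: divide_ennreal)
  finally show ?thesis .
next
  case False
  \<comment> \<open>Now 2 \<rho> is at least 1, the total mass.\<close>
  have "emeasure circle_borel (cis ` {-2*pi*\<rho>..2*pi*\<rho>}) \<le> 1"
    using emeasure_space[of circle_borel] by (simp add: emeasure_circle_borel_space)
  also have "1 \<le> ennreal (2 * \<rho>)" using False by simp
  finally show ?thesis .
qed

text \<open>Rotation by \<open>cnj z\<close> carries every ball about z into one fixed arc about 1,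
  so a return becomes an event about F(z) / z alone. The closed arc is compact, hence Borel.\<close>

lemma circle_ball_subset_arc:
  assumes "norm z = 1" "w \<in> circle_ball z \<rho>"
  shows "w * cnj z \<in> cis ` {-2*pi*\<rho>..2*pi*\<rho>}"
proof -
  have 1: "w / z = w * cnj z"
    using assms(1) by (rule divide_conv_cnj)
  have "norm w = 1" "\<bar>Arg (w / z)\<bar> / (2 * pi) < \<rho>"
    using assms(2) by (auto simp: circle_ball_def circle_dist_def)
  then have "\<bar>Arg (w * cnj z)\<bar> < 2 * pi * \<rho>"
    unfolding 1 by (simp add: field_simps)
  moreover have "w * cnj z = cis (Arg (w * cnj z))"
    using assms(1) \<open>norm w = 1\<close> by (subst cis_Arg) (auto simp: sgn_div_norm norm_mult)
  ultimately show ?thesis by (intro image_eqI) auto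
qed

lemma emeasure_density_poisson_kernel_le:
  assumes a: "norm a \<le> \<alpha>" "\<alpha> < 1" and A: "A \<in> sets borel"
  shows "emeasure (density circle_borel (poisson_kernel a)) A
    \<le> ennreal ((1 + \<alpha>) / (1 - \<alpha>)) * emeasure circle_borel A"
proof -
  have "emeasure (density circle_borel (poisson_kernel a)) A =
      (\<integral>\<^sup>+z. ennreal (poisson_kernel a z) * indicator A z \<partial>circle_borel)"
    using A by (subst emeasure_density) auto
  also have "\<dots> \<le> (\<integral>\<^sup>+z. ennreal ((1 + \<alpha>) / (1 - \<alpha>)) * indicator A z \<partial>circle_borel)"
    using AE_circle_borel_norm
    by (intro nn_integral_mono_AE)
      (auto elim!: eventually_mono intro!: mult_right_mono ennreal_leI poisson_kernel_le[OF a])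
  also have "\<dots> = ennreal ((1 + \<alpha>) / (1 - \<alpha>)) * emeasure circle_borel A"
    using A by (simp add: nn_integral_cmult_indicator)
  finally show ?thesis .
qed

text \<open>The random variable \<open>F\<^sub>n(z) / z\<close> has the \<open>m\<close>-th moment \<open>a\<^sup>m\<close>, so its law is the Poisson measure
  of \<open>a\<close>.\<close>

lemma return_set_bound:
  fixes f :: "nat \<Rightarrow> complex \<Rightarrow> complex"
  assumes inner: "\<And>n. n \<ge> 1 \<Longrightarrow> inner_function (f n)"
    and centred: "\<And>n. n \<ge> 1 \<Longrightarrow> f n 0 = 0"
    and \<alpha>: "norm (\<Prod>i=1..n. deriv (f i) 0) \<le> \<alpha>" "\<alpha> < 1"
    and \<rho>: "0 < \<rho>"
  obtains A where "A \<in> sets borel" "measure circle_borel A \<le> (1 + \<alpha>) / (1 - \<alpha>) * (2 * \<rho>)"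
    and "AE z in circle_borel. \<forall>w. boundary_iter f n z = Some w \<and> w \<in> circle_ball z \<rho> \<longrightarrow> z \<in> A"
proof -
  define a where "a = (\<Prod>i=1..n. deriv (f i) 0)"
  have a: "norm a \<le> \<alpha>" "norm a < 1" using \<alpha> by (auto simp: a_def)
  obtain X where [measurable]: "X \<in> borel_measurable borel"
    and X: "AE z in circle_borel. norm (X z) = 1 \<and> boundary_iter f n z = Some (X z)"
    and mom: "\<And>j k. k \<le> j \<Longrightarrow> (\<integral>z. X z ^ j * cnj z ^ k \<partial>circle_borel) = (if j = k then a ^ k else 0)"
    using boundary_iter_moments[where f=f and n=n, OF inner centred] unfolding a_def by blast
  define N where "N = density circle_borel (poisson_kernel a)"
  have intN: "(\<integral>z. z ^ m \<partial>N) = a ^ m" for m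
    unfolding N_def using a poisson_moment[of a m]
    by (subst integral_density) (auto simp: poisson_kernel_nonneg)
  have law: "distr circle_borel borel (\<lambda>z. X z * cnj z) = N"
  proof (rule distr_circle_borel_eqI)
    show "AE z in circle_borel. norm (X z * cnj z) = 1"
      using X AE_circle_borel_norm by eventually_elim (simp add: norm_mult)
    show "(\<integral>z. (X z * cnj z) ^ m \<partial>circle_borel) = (\<integral>z. z ^ m \<partial>N)" for m
      using mom[of m m] by (simp add: power_mult_distrib intN)
    have "emeasure N UNIV \<le> ennreal ((1 + \<alpha>) / (1 - \<alpha>)) * 1"
      unfolding N_def using emeasure_density_poisson_kernel_le[OF a(1) \<alpha>(2), of UNIV]
      by (simp add: emeasure_circle_borel_space)
    then show "finite_measure N"
      by (intro finite_measureI) (auto simp: N_def top_unique)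
    show "AE z in N. norm z = 1"
      unfolding N_def using AE_circle_borel_norm by (subst AE_density) auto
  qed (simp_all add: N_def)
  define K where "K = cis ` {-2*pi*\<rho>..2*pi*\<rho>}"
  have "compact K"
    unfolding K_def by (intro compact_continuous_image continuous_intros) auto
  then have [measurable]: "K \<in> sets borel" by (simp add: borel_compact)
  \<comment> \<open>Defined through the total function \<open>X\<close>, this set is Borel and
    contains the return set up to a null set. Measurability of the return set itself need not be
    discussed.\<close>
  define A where "A = (\<lambda>z. X z * cnj z) -` K"
  have A: "A \<in> sets borel"
    unfolding A_def using measurable_sets[of "\<lambda>z. X z * cnj z" borel borel K] by simp
  have C: "0 \<le> (1 + \<alpha>) / (1 - \<alpha>)" using a \<alpha>(2) norm_ge_zero[of a] by (intro divide_nonneg_nonneg) linarith+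
  have "emeasure circle_borel A = emeasure N K"
    unfolding law[symmetric] A_def by (subst emeasure_distr) auto
  also have "\<dots> \<le> ennreal ((1 + \<alpha>) / (1 - \<alpha>)) * emeasure circle_borel K"
    unfolding N_def by (rule emeasure_density_poisson_kernel_le[OF a(1) \<alpha>(2)]) simp
  also have "\<dots> \<le> ennreal ((1 + \<alpha>) / (1 - \<alpha>)) * ennreal (2 * \<rho>)"
    unfolding K_def by (intro mult_left_mono emeasure_arc_le \<rho>) simp
  also have "\<dots> = ennreal ((1 + \<alpha>) / (1 - \<alpha>) * (2 * \<rho>))"
    using C \<rho> by (intro ennreal_mult[symmetric]) auto
  finally have "measure circle_borel A \<le> (1 + \<alpha>) / (1 - \<alpha>) * (2 * \<rho>)"
    unfolding circle_borel.emeasure_eq_measure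
    by (rule ennreal_le_iff[THEN iffD1, rotated]) (rule mult_nonneg_nonneg[OF C], use \<rho> in simp)
  moreover have "AE z in circle_borel. \<forall>w. boundary_iter f n z = Some w \<and> w \<in> circle_ball z \<rho> \<longrightarrow> z \<in> A"
    using X AE_circle_borel_norm
    by eventually_elim (auto simp: A_def K_def dest: circle_ball_subset_arc)
  ultimately show ?thesis using A that by blast
qed

section \<open>The Borel-Cantelli argument for the recurrence set\<close>

theorem theorem5:
  fixes f :: "nat \<Rightarrow> complex \<Rightarrow> complex" and r :: "nat \<Rightarrow> real" and \<alpha> :: real
  assumes inner: "\<And>n. n \<ge> 1 \<Longrightarrow> inner_function (f n)"
    and centred: "\<And>n. n \<ge> 1 \<Longrightarrow> f n 0 = 0"
    and contracting: "\<alpha> < 1" "\<And>n. n \<ge> 1 \<Longrightarrow> norm (deriv (f n) 0) \<le> \<alpha>"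
    and r_pos: "\<And>n. n \<ge> 1 \<Longrightarrow> r n > 0"
    and r_summable: "summable (\<lambda>n. r (Suc n))"
  shows "recurrence_set f r \<in> null_sets circle_measure"
proof -
  \<comment> \<open>One factor is at most \<alpha> and the others are at most 1. The index
    \<open>Suc n\<close> guarantees a factor, whereas the empty product is 1; hence the shift by one
    in \<open>P\<close> and \<open>A\<close> below.\<close>
  have \<alpha>: "norm (\<Prod>i=1..Suc n. deriv (f i) 0) \<le> \<alpha>" for n
  proof -
    have "norm (\<Prod>i=1..n. deriv (f i) 0) \<le> 1"
      unfolding prod_norm[symmetric] using contracting
      by (intro prod_le_1) (auto intro: order_trans less_imp_le)
    then have "norm (\<Prod>i=1..n. deriv (f i) 0) * norm (deriv (f (Suc n)) 0) \<le> 1 * \<alpha>"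
      using contracting(2)[of "Suc n"] by (intro mult_mono) auto
    then show ?thesis by (simp add: norm_mult)
  qed
  define C where "C = (1 + \<alpha>) / (1 - \<alpha>)"
  define P where "P n A \<longleftrightarrow> A \<in> sets borel \<and> measure circle_borel A \<le> C * (2 * r (Suc n)) \<and>
    (AE z in circle_borel. \<forall>w. boundary_iter f (Suc n) z = Some w \<and> w \<in> circle_ball z (r (Suc n)) \<longrightarrow> z \<in> A)"
    for n A
  have "\<exists>A. P n A" for n
    unfolding P_def C_def
    by (rule return_set_bound[where f=f, OF inner centred \<alpha>[of n] contracting(1) r_pos[of "Suc n"]])
      (assumption | simp | blast)+
  then obtain A where "\<And>n. P n (A n)" by metis
  then have A: "\<And>n. A n \<in> sets borel" "\<And>n. measure circle_borel (A n) \<le> C * (2 * r (Suc n))"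
    and ret: "\<And>n. AE z in circle_borel. \<forall>w. boundary_iter f (Suc n) z = Some w \<and>
      w \<in> circle_ball z (r (Suc n)) \<longrightarrow> z \<in> A n"
    by (simp_all only: P_def)
  have "summable (\<lambda>n. measure circle_borel (A n))"
    by (rule summable_comparison_test'[OF summable_mult[OF summable_mult[OF r_summable]]]) (use A in auto)
  then have "AE z in circle_borel. eventually (\<lambda>n. z \<in> space circle_borel - A n) sequentially"
    using A by (intro borel_cantelli_AE1) (auto simp: circle_borel.emeasure_eq_measure)
  moreover have "AE z in circle_borel. \<forall>n w. boundary_iter f (Suc n) z = Some w \<and>
      w \<in> circle_ball z (r (Suc n)) \<longrightarrow> z \<in> A n"
    using ret by (simp add: AE_all_countable)
  ultimately have "AE z in circle_borel. z \<notin> recurrence_set f r"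
  proof eventually_elim
    case (elim z)
    then obtain m where m: "\<And>n. n \<ge> m \<Longrightarrow> z \<notin> A n"
      by (auto simp: eventually_sequentially)
    \<comment> \<open>Undoing the shift: the n-th return is governed by \<open>A (n - 1)\<close>, so
      n has to be at least \<open>Suc m\<close>.\<close>
    have "\<not> (\<exists>w. boundary_iter f n z = Some w \<and> w \<in> circle_ball z (r n))" if "n \<ge> Suc m" for n
      using elim(2)[rule_format, of "n - 1"] m[of "n - 1"] that by auto
    then have "\<not> (\<exists>\<^sub>\<infinity>n. \<exists>w. boundary_iter f n z = Some w \<and> w \<in> circle_ball z (r n))"
      unfolding INFM_nat_le by blast
    then show ?case by (simp add: recurrence_set_def)
  qed
  then have "AE z in circle_measure. z \<notin> recurrence_set f r"
    unfolding AE_circle_measure_iff by (auto elim: eventually_mono)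
  moreover have "recurrence_set f r \<subseteq> space circle_measure"
    by (auto simp: recurrence_set_def)
  \<comment> \<open>In a completed measure, a subset of the space that almost every point avoids is
    a null set, so the measurability of the recurrence set comes for free.\<close>
  ultimately show ?thesis
    unfolding circle_measure_def completion.null_sets_iff_AE by simp
qed

end
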